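(* Let $y^t=\{y_\tau,f'(y_\tau)\}_{\tau=1}^t$ with $y_\tau\in Y$, and let $\lambda^t=\{\lambda_\tau\}_{\tau=1}^t$ with $\lambda_\tau\ge 0$ and $\sum_{\tau=1}^t\lambda_\tau=1$. Set $$\widehat{x}=\sum_{\tau=1}^t\lambda_\tau x_X(Ay_\tau+a),\qquad \widehat{y}=\sum_{\tau=1}^t\lambda_\tau y_\tau,\qquad \epsilon(y^t,\lambda^t)=\max_{y\in Y}\sum_{\tau=1}^t\lambda_\tau\langle f'(y_\tau),y_\tau-y\rangle .$$ Then $\widehat{x}$ and $\widehat{y}$ are feasible solutions to problems $(P)$ and $(D)$, respectively (that is, $\widehat{x}\in X$, $\widehat{y}\in Y$), and $$f(\widehat{y})-f_*(\widehat{x})=\left[f(\widehat{y})-\mathrm{Opt}(D)\right]+\left[\mathrm{Opt}(P)-f_*(\widehat{x})\right]\le \epsilon(y^t,\lambda^t).$$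
   Context: $E_x,E_y$ are Euclidean spaces (finite-dimensional, with inner products denoted $\langle\cdot,\cdot\rangle$). $X\subset E_x$ is a nonempty closed and bounded convex set, and for every $\xi\in E_x$, $x_X(\xi)$ denotes a fixed (oracle-supplied) maximizer of the linear form $\langle \xi,x\rangle$ over $x\in X$. $Y\subset E_y$ is a nonempty convex compact set, $A:E_y\to E_x$ is a linear mapping with adjoint $A^T$, $a\in E_x$, and $\psi:Y\to\mathbf{R}$ is a Lipschitz continuous convex function; $\psi'(y)\in\partial\psi(y)$ is a fixed selection of subgradients of $\psi$ on $Y$. Set $$f_*(x)=\min_{y\in Y}\left[\langle x,Ay+a\rangle+\psi(y)\right]\ (x\in X),\qquad f(y)=\max_{x\in X}\left[\langle x,Ay+a\rangle+\psi(y)\right]\ (y\in Y),$$ and consider the problems $$(P):\ \mathrm{Opt}(P)=\max_{x\in X}f_*(x),\qquad (D):\ \mathrm{Opt}(D)=\min_{y\in Y}f(y).$$ The vector field $f'$ on $Y$ is defined by $f'(y)=A^Tx_X(Ay+a)+\psi'(y)$. *)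

theory Defs
  imports "HOL-Analysis.Analysis"
begin

text \<open>
  Minima and maxima are literal least and greatest values: \<open>LEAST v. v \<in> g ` S\<close> and
  \<open>GREATEST v. v \<in> g ` S\<close> denote the optimal value of \<open>g\<close> over \<open>S\<close> and are unspecified when
  the optimum is not attained.
\<close>

definition max_over :: "'a set \<Rightarrow> ('a \<Rightarrow> real) \<Rightarrow> real"
  where "max_over S g = (GREATEST v. v \<in> g ` S)"

definition min_over :: "'a set \<Rightarrow> ('a \<Rightarrow> real) \<Rightarrow> real"
  where "min_over S g = (LEAST v. v \<in> g ` S)"

text \<open>
  The subdifferential at \<open>y \<in> Y\<close> of a function whose domain is \<open>Y\<close>: the subgradient
  inequality is required on \<open>Y\<close> only, the values of \<open>\<psi>\<close> outside \<open>Y\<close> being irrelevant.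
\<close>

definition subdifferential_on :: "'a::real_inner set \<Rightarrow> ('a \<Rightarrow> real) \<Rightarrow> 'a \<Rightarrow> 'a set"
  where "subdifferential_on Y \<psi> y = {g. \<forall>z\<in>Y. \<psi> z \<ge> \<psi> y + g \<bullet> (z - y)}"

definition is_linear_max_oracle :: "'a::real_inner set \<Rightarrow> ('a \<Rightarrow> 'a) \<Rightarrow> bool"
  where "is_linear_max_oracle X xX \<longleftrightarrow>
    (\<forall>\<xi>. xX \<xi> \<in> X \<and> (\<forall>x\<in>X. \<xi> \<bullet> x \<le> \<xi> \<bullet> xX \<xi>))"

definition primal_obj ::
    "'y set \<Rightarrow> ('y \<Rightarrow> 'x) \<Rightarrow> 'x \<Rightarrow> ('y \<Rightarrow> real) \<Rightarrow> 'x::real_inner \<Rightarrow> real"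
  where "primal_obj Y A a \<psi> x = min_over Y (\<lambda>y. x \<bullet> (A y + a) + \<psi> y)"

definition dual_obj ::
    "'x::real_inner set \<Rightarrow> ('y \<Rightarrow> 'x) \<Rightarrow> 'x \<Rightarrow> ('y \<Rightarrow> real) \<Rightarrow> 'y \<Rightarrow> real"
  where "dual_obj X A a \<psi> y = max_over X (\<lambda>x. x \<bullet> (A y + a) + \<psi> y)"

definition OptP ::
    "'x::real_inner set \<Rightarrow> 'y set \<Rightarrow> ('y \<Rightarrow> 'x) \<Rightarrow> 'x \<Rightarrow> ('y \<Rightarrow> real) \<Rightarrow> real"
  where "OptP X Y A a \<psi> = max_over X (primal_obj Y A a \<psi>)"

definition OptD ::
    "'x::real_inner set \<Rightarrow> 'y set \<Rightarrow> ('y \<Rightarrow> 'x) \<Rightarrow> 'x \<Rightarrow> ('y \<Rightarrow> real) \<Rightarrow> real"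
  where "OptD X Y A a \<psi> = min_over Y (dual_obj X A a \<psi>)"

definition dual_field ::
    "('x::euclidean_space \<Rightarrow> 'x) \<Rightarrow> ('y::euclidean_space \<Rightarrow> 'x) \<Rightarrow> 'x \<Rightarrow> ('y \<Rightarrow> 'y) \<Rightarrow> 'y \<Rightarrow> 'y"
  where "dual_field xX A a \<psi>' y = adjoint A (xX (A y + a)) + \<psi>' y"

text \<open>
  The accuracy \<open>\<epsilon>(y\<^sup>t, \<lambda>\<^sup>t)\<close> of the execution protocol with points \<open>ys \<tau>\<close>, field values
  \<open>gs \<tau>\<close> and weights \<open>lam \<tau>\<close>, for \<open>1 \<le> \<tau> \<le> t\<close>.
\<close>

definition certificate_accuracy ::
    "'y::real_inner set \<Rightarrow> nat \<Rightarrow> (nat \<Rightarrow> 'y) \<Rightarrow> (nat \<Rightarrow> 'y) \<Rightarrow> (nat \<Rightarrow> real) \<Rightarrow> real"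
  where "certificate_accuracy Y t ys gs lam =
    max_over Y (\<lambda>y. \<Sum>\<tau>=1..t. lam \<tau> * (gs \<tau> \<bullet> (ys \<tau> - y)))"

end

theory Submission
  imports Defs
begin

text \<open>
  Write \<open>\<phi> x y = x \<bullet> (A y + a) + \<psi> y\<close>. Two facts combine.

  The first is strong duality: \<open>\<phi>\<close> is affine in \<open>x\<close> and convex in \<open>y\<close>, so it has a saddle point on
  the compact set \<open>X \<times> Y\<close>, and the value there is both \<open>OptP\<close> and \<open>OptD\<close>. Hence the two optimal
  values cancel in the sum of the two residuals. The saddle point is found by regularisation
  (\<open>concave_convex_saddle_point\<close>): subtracting \<open>\<epsilon> (x \<bullet> x)\<close> makes the function strongly concave in
  \<open>x\<close>, so that the inner maximiser depends continuously on \<open>y\<close>. A first-order argument along the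
  segments of \<open>Y\<close> that start at a minimiser of the outer function then gives a saddle point
  (\<open>strongly_concave_convex_saddle_point\<close>); finally \<open>\<epsilon>\<close> tends to \<open>0\<close>.

  The second bounds the duality gap. With \<open>x\<^sub>\<tau> = xX (A y\<^sub>\<tau> + a)\<close>, the subgradient inequality for
  \<open>\<psi>\<close> and the definition of the adjoint give
  \<open>f' y\<^sub>\<tau> \<bullet> (y\<^sub>\<tau> - y) \<ge> \<phi> x\<^sub>\<tau> y\<^sub>\<tau> - \<phi> x\<^sub>\<tau> y = f y\<^sub>\<tau> - \<phi> x\<^sub>\<tau> y\<close> for every \<open>y \<in> Y\<close>. Averaging
  with the weights, \<open>\<phi>\<close> being affine in \<open>x\<close> and \<open>f\<close> convex, bounds the average from below by
  \<open>f yhat - \<phi> xhat y\<close>; the minimiser \<open>y\<close> of \<open>\<phi> xhat\<close> turns this into the duality gap.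
\<close>

section \<open>Attained optimal values\<close>

lemma max_over_eqI:
  assumes "s \<in> S" and "\<And>x. x \<in> S \<Longrightarrow> g x \<le> g s"
  shows "max_over S g = g s"
  unfolding max_over_def using assms by (intro Greatest_equality) auto

lemma min_over_eqI:
  assumes "s \<in> S" and "\<And>x. x \<in> S \<Longrightarrow> g s \<le> g x"
  shows "min_over S g = g s"
  unfolding min_over_def using assms by (intro Least_equality) auto

lemma max_over_upper:
  assumes "compact S" and "continuous_on S g" and "x \<in> S"
  shows "g x \<le> max_over S g"
proof -
  obtain s where s: "s \<in> S" "\<forall>x\<in>S. g x \<le> g s"
    using continuous_attains_sup[of S g] assms by auto
  then have "max_over S g = g s"
    by (intro max_over_eqI) auto
  with s assms(3) show ?thesis by simp
qed

text \<open>
  Both optimal values are attained at the saddle point and equal \<open>\<phi> x y\<close>. As \<open>min_over\<close> and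
  \<open>max_over\<close> are unspecified where an optimum is not attained, the last two hypotheses are what
  makes the inner optima away from the saddle point bounds for \<open>\<phi>\<close>.
\<close>

lemma saddle_point_max_min_eq_min_max:
  assumes x: "x \<in> X" and y: "y \<in> Y"
    and saddle: "\<And>x' y'. x' \<in> X \<Longrightarrow> y' \<in> Y \<Longrightarrow> \<phi> x' y \<le> \<phi> x y'"
    and inner_min: "\<And>x' y'. x' \<in> X \<Longrightarrow> y' \<in> Y \<Longrightarrow> min_over Y (\<phi> x') \<le> \<phi> x' y'"
    and inner_max: "\<And>x' y'. x' \<in> X \<Longrightarrow> y' \<in> Y \<Longrightarrow> \<phi> x' y' \<le> max_over X (\<lambda>x. \<phi> x y')"
  shows "max_over X (\<lambda>x. min_over Y (\<phi> x)) = min_over Y (\<lambda>y. max_over X (\<lambda>x. \<phi> x y))"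
proof -
  have mn: "min_over Y (\<phi> x) = \<phi> x y"
    using saddle[OF x] y by (intro min_over_eqI) auto
  have mx: "max_over X (\<lambda>x. \<phi> x y) = \<phi> x y"
    using saddle[OF _ y] x by (intro max_over_eqI[where g = "\<lambda>x. \<phi> x y"]) auto
  have "max_over X (\<lambda>x. min_over Y (\<phi> x)) = min_over Y (\<phi> x)"
    using x
  proof (rule max_over_eqI)
    fix x' assume "x' \<in> X"
    then have "min_over Y (\<phi> x') \<le> \<phi> x' y" "\<phi> x' y \<le> \<phi> x y"
      using inner_min saddle y by auto
    then show "min_over Y (\<phi> x') \<le> min_over Y (\<phi> x)"
      using mn by simp
  qed
  moreover have "min_over Y (\<lambda>y. max_over X (\<lambda>x. \<phi> x y)) = max_over X (\<lambda>x. \<phi> x y)"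
    using y
  proof (rule min_over_eqI)
    fix y' assume "y' \<in> Y"
    then have "\<phi> x y \<le> \<phi> x y'" "\<phi> x y' \<le> max_over X (\<lambda>x. \<phi> x y')"
      using inner_max saddle x by auto
    then show "max_over X (\<lambda>x. \<phi> x y) \<le> max_over X (\<lambda>x. \<phi> x y')"
      using mx by simp
  qed
  ultimately show ?thesis
    using mn mx by simp
qed

section \<open>Existence of saddle points\<close>

text \<open>
  By uniform continuity, moving \<open>y\<close> slightly changes \<open>\<phi> x y\<close> by less than \<open>e\<close> for all \<open>x\<close> at
  once, hence also the maximum, even though the maximiser \<open>\<xi> y\<close> may jump.
\<close>

lemma continuous_on_partial_max:
  fixes \<phi> :: "'x::metric_space \<Rightarrow> 'y::metric_space \<Rightarrow> real"
  assumes "compact X" and "compact Y"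
    and cont: "continuous_on (X \<times> Y) (\<lambda>p. \<phi> (fst p) (snd p))"
    and \<xi>: "\<And>y. y \<in> Y \<Longrightarrow> \<xi> y \<in> X"
    and \<xi>_max: "\<And>x y. x \<in> X \<Longrightarrow> y \<in> Y \<Longrightarrow> \<phi> x y \<le> \<phi> (\<xi> y) y"
  shows "continuous_on Y (\<lambda>y. \<phi> (\<xi> y) y)"
proof -
  have unif: "uniformly_continuous_on (X \<times> Y) (\<lambda>p. \<phi> (fst p) (snd p))"
    using assms by (intro compact_uniformly_continuous compact_Times)
  have "\<exists>d>0. \<forall>z\<in>Y. dist z y < d \<longrightarrow> dist (\<phi> (\<xi> z) z) (\<phi> (\<xi> y) y) < e"
    if y: "y \<in> Y" and e: "e > 0" for y e
  proof -
    obtain d where d: "d > 0"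
      and close: "\<And>p q. p \<in> X \<times> Y \<Longrightarrow> q \<in> X \<times> Y \<Longrightarrow> dist q p < d \<Longrightarrow>
        dist (\<phi> (fst q) (snd q)) (\<phi> (fst p) (snd p)) < e"
      using unif e unfolding uniformly_continuous_on_def by metis
    have "dist (\<phi> (\<xi> z) z) (\<phi> (\<xi> y) y) < e" if z: "z \<in> Y" "dist z y < d" for z
    proof -
      have near: "\<bar>\<phi> x z - \<phi> x y\<bar> < e" if "x \<in> X" for x
        using close[of "(x, y)" "(x, z)"] that y z by (simp add: dist_Pair_Pair dist_real_def)
      show ?thesis
        using near[OF \<xi>[OF y]] near[OF \<xi>[OF z(1)]]
          \<xi>_max[OF \<xi>[OF y] z(1)] \<xi>_max[OF \<xi>[OF z(1)] y]
        by (simp add: dist_real_def abs_less_iff)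
    qed
    with d show ?thesis by blast
  qed
  then show ?thesis
    unfolding continuous_on_iff by blast
qed

text \<open>
  Let \<open>y0\<close> minimise the outer function \<open>v\<close> and let \<open>x0\<close> be the maximiser at \<open>y0\<close>. Along the
  segment from \<open>y0\<close> to \<open>y'\<close> the outer function stays above \<open>v y0\<close>, and convexity in \<open>y\<close> transfers
  this to \<open>\<phi> w y' \<ge> v y0\<close> for the maximiser \<open>w\<close> at a point of the segment. Strong concavity forces
  \<open>w\<close> to converge to \<open>x0\<close> as the point approaches \<open>y0\<close>, whatever \<open>y'\<close> is; so the one point \<open>x0\<close>
  satisfies \<open>\<phi> x0 y' \<ge> v y0\<close> for all \<open>y'\<close>.
\<close>

lemma strongly_concave_convex_saddle_point:
  fixes \<phi> :: "'x::real_normed_vector \<Rightarrow> 'y::real_normed_vector \<Rightarrow> real"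
  assumes X: "X \<noteq> {}" "compact X" "convex X"
    and Y: "Y \<noteq> {}" "compact Y" "convex Y"
    and cont: "continuous_on (X \<times> Y) (\<lambda>p. \<phi> (fst p) (snd p))"
    and c: "c > 0"
    and strong: "\<And>x x' y. x \<in> X \<Longrightarrow> x' \<in> X \<Longrightarrow> y \<in> Y \<Longrightarrow>
      (\<phi> x y + \<phi> x' y) / 2 + c * (norm (x - x'))\<^sup>2 \<le> \<phi> ((1/2) *\<^sub>R x + (1/2) *\<^sub>R x') y"
    and conv: "\<And>x. x \<in> X \<Longrightarrow> convex_on Y (\<phi> x)"
  shows "\<exists>x\<in>X. \<exists>y\<in>Y. \<forall>x'\<in>X. \<forall>y'\<in>Y. \<phi> x' y \<le> \<phi> x y'"
proof -
  have cont_x: "continuous_on X (\<lambda>x. \<phi> x y)" if "y \<in> Y" for y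
  proof -
    have "continuous_on X (\<lambda>x. (x, y))" "(\<lambda>x. (x, y)) ` X \<subseteq> X \<times> Y"
      using that by (auto intro!: continuous_intros)
    from continuous_on_compose2[OF cont this] show ?thesis by simp
  qed
  have "\<forall>y\<in>Y. \<exists>x\<in>X. \<forall>x'\<in>X. \<phi> x' y \<le> \<phi> x y"
    using continuous_attains_sup[OF X(2,1) cont_x] by blast
  then obtain \<xi> where \<xi>: "\<And>y. y \<in> Y \<Longrightarrow> \<xi> y \<in> X"
    and \<xi>_max: "\<And>x y. x \<in> X \<Longrightarrow> y \<in> Y \<Longrightarrow> \<phi> x y \<le> \<phi> (\<xi> y) y"
    by metis
  define v where "v y = \<phi> (\<xi> y) y" for y
  have "continuous_on Y v"
    unfolding v_def using continuous_on_partial_max[OF X(2) Y(2) cont, of \<xi>] \<xi> \<xi>_max by blast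
  then obtain y0 where y0: "y0 \<in> Y" and v_min: "\<And>y. y \<in> Y \<Longrightarrow> v y0 \<le> v y"
    using continuous_attains_inf[OF Y(2,1)] by blast
  define x0 where "x0 = \<xi> y0"
  have x0: "x0 \<in> X" using \<xi> y0 by (simp add: x0_def)
  \<comment> \<open>Compare the maximum with the value at the midpoint of \<open>x\<close> and \<open>x0\<close>.\<close>
  have growth: "\<phi> x y0 \<le> v y0 - 2 * c * (norm (x - x0))\<^sup>2" if "x \<in> X" for x
  proof -
    have mid: "(1/2) *\<^sub>R x + (1/2) *\<^sub>R x0 \<in> X"
      using convexD[OF X(3) that x0, of "1/2" "1/2"] by simp
    have "(\<phi> x y0 + v y0) / 2 + c * (norm (x - x0))\<^sup>2 \<le> v y0"
      using strong[OF that x0 y0] \<xi>_max[OF mid y0] by (simp add: v_def x0_def)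
    then show ?thesis by (simp add: field_simps)
  qed
  have "v y0 \<le> \<phi> x0 y'" if y': "y' \<in> Y" for y'
  proof -
    \<comment> \<open>The step sizes are positive, tend to \<open>0\<close> and stay away from \<open>1\<close>.\<close>
    define s where "s n = inverse (real (Suc (Suc n)))" for n
    define z where "z n = (1 - s n) *\<^sub>R y0 + s n *\<^sub>R y'" for n
    define w where "w n = \<xi> (z n)" for n
    define K where "K = v y' - v y0"
    have s: "0 < s n" "s n \<le> 1/2" for n
      by (auto simp: s_def field_simps)
    have z: "z n \<in> Y" for n
      unfolding z_def using s[of n] by (intro convexD[OF Y(3) y0 y']) auto
    have w: "w n \<in> X" for n
      using \<xi> z by (simp add: w_def)
    have seg: "v y0 \<le> (1 - s n) * \<phi> (w n) y0 + s n * \<phi> (w n) y'" for n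
    proof -
      have "v y0 \<le> \<phi> (w n) (z n)"
        using v_min[OF z[of n]] by (simp add: v_def w_def)
      also have "\<dots> \<le> (1 - s n) * \<phi> (w n) y0 + s n * \<phi> (w n) y'"
        unfolding z_def using convex_onD[OF conv[OF w[of n]]] s[of n] y0 y' by auto
      finally show ?thesis .
    qed
    have above: "v y0 \<le> \<phi> (w n) y'" for n
    proof -
      have "(1 - s n) * \<phi> (w n) y0 \<le> (1 - s n) * v y0"
        using \<xi>_max[OF w y0] s[of n] by (intro mult_left_mono) (auto simp: v_def)
      then have "s n * v y0 \<le> s n * \<phi> (w n) y'"
        using seg[of n] by (simp add: algebra_simps)
      then show ?thesis using s[of n] by simp
    qed
    have dist_bound: "(norm (w n - x0))\<^sup>2 \<le> s n * (K / c)" for n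
    proof -
      let ?D = "2 * c * (norm (w n - x0))\<^sup>2"
      have "v y0 \<le> (1 - s n) * (v y0 - ?D) + s n * v y'"
      proof (rule order_trans[OF seg[of n]], rule add_mono)
        show "(1 - s n) * \<phi> (w n) y0 \<le> (1 - s n) * (v y0 - ?D)"
          using growth[OF w[of n]] s[of n] by (intro mult_left_mono) auto
        show "s n * \<phi> (w n) y' \<le> s n * v y'"
          using \<xi>_max[OF w[of n] y'] s[of n] by (simp add: v_def)
      qed
      then have "(1 - s n) * ?D \<le> s n * K"
        by (simp add: K_def algebra_simps)
      moreover have "(1/2) * ?D \<le> (1 - s n) * ?D"
        using s[of n] c by (intro mult_right_mono) auto
      ultimately have "c * (norm (w n - x0))\<^sup>2 \<le> s n * K"
        by linarith
      then show ?thesis using c by (simp add: field_simps)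
    qed
    have "s \<longlonglongrightarrow> 0"
      unfolding s_def using LIMSEQ_Suc[OF LIMSEQ_inverse_real_of_nat] .
    then have "(\<lambda>n. s n * (K / c)) \<longlonglongrightarrow> 0"
      by (rule tendsto_mult_left_zero)
    then have "(\<lambda>n. (norm (w n - x0))\<^sup>2) \<longlonglongrightarrow> 0"
      by (rule tendsto_sandwich[OF _ _ tendsto_const, rotated 2])
        (intro always_eventually allI zero_le_power2 dist_bound)+
    then have "w \<longlonglongrightarrow> x0"
      by (simp add: tendsto_norm_zero_iff LIM_zero_iff)
    then have "(\<lambda>n. \<phi> (w n) y') \<longlonglongrightarrow> \<phi> x0 y'"
      by (rule continuous_on_tendsto_compose[OF cont_x[OF y'] _ x0]) (simp add: w)
    then show ?thesis
      by (rule LIMSEQ_le_const) (use above in auto)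
  qed
  then have "\<forall>x'\<in>X. \<forall>y'\<in>Y. \<phi> x' y0 \<le> \<phi> x0 y'"
    using \<xi>_max[OF _ y0] unfolding v_def by (meson order_trans)
  with x0 y0 show ?thesis by blast
qed

text \<open>
  Saddle points of the regularised functions \<open>\<phi> x y - \<epsilon> (x \<bullet> x)\<close> satisfy the saddle inequality
  for \<open>\<phi>\<close> up to the error \<open>\<epsilon> (x' \<bullet> x')\<close>, so any limit point as \<open>\<epsilon>\<close> tends to \<open>0\<close> is a saddle point
  of \<open>\<phi>\<close>.
\<close>

theorem concave_convex_saddle_point:
  fixes \<phi> :: "'x::real_inner \<Rightarrow> 'y::real_normed_vector \<Rightarrow> real"
  assumes X: "X \<noteq> {}" "compact X" "convex X"
    and Y: "Y \<noteq> {}" "compact Y" "convex Y"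
    and cont: "continuous_on (X \<times> Y) (\<lambda>p. \<phi> (fst p) (snd p))"
    and conc: "\<And>y. y \<in> Y \<Longrightarrow> concave_on X (\<lambda>x. \<phi> x y)"
    and conv: "\<And>x. x \<in> X \<Longrightarrow> convex_on Y (\<phi> x)"
  obtains x y where "x \<in> X" "y \<in> Y" "\<And>x' y'. x' \<in> X \<Longrightarrow> y' \<in> Y \<Longrightarrow> \<phi> x' y \<le> \<phi> x y'"
proof -
  define e where "e n = inverse (real (Suc n))" for n
  have e: "e n > 0" for n by (simp add: e_def)
  have regularised: "\<exists>x\<in>X. \<exists>y\<in>Y. \<forall>x'\<in>X. \<forall>y'\<in>Y.
      \<phi> x' y - e n * (x' \<bullet> x') \<le> \<phi> x y' - e n * (x \<bullet> x)" for n
    \<comment> \<open>The constant is the midpoint defect of \<open>e n * (x \<bullet> x)\<close> in the parallelogram law.\<close>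
  proof (rule strongly_concave_convex_saddle_point[OF X Y, where c = "e n / 4"])
    show "continuous_on (X \<times> Y) (\<lambda>p. \<phi> (fst p) (snd p) - e n * (fst p \<bullet> fst p))"
      by (intro continuous_intros cont)
    show "e n / 4 > 0" using e[of n] by simp
    show "convex_on Y (\<lambda>y. \<phi> x y - e n * (x \<bullet> x))" if "x \<in> X" for x
      using convex_on_add[OF conv[OF that] convex_on_const[THEN iffD2], of "- e n * (x \<bullet> x)"] Y(3)
      by simp
    fix x x' y assume *: "x \<in> X" "x' \<in> X" "y \<in> Y"
    have arith: "(p - k * g + (q - k * h)) / 2 + k / 4 * d \<le> r - k * i"
      if "(p + q) / 2 \<le> r" "i = (g + h) / 2 - d / 4" for p q r g h i d k :: real
      unfolding that(2) using that(1) by (simp add: field_simps)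
    define m where "m = (1/2) *\<^sub>R x + (1/2) *\<^sub>R x'"
    have "(\<phi> x y + \<phi> x' y) / 2 \<le> \<phi> m y"
      using concave_onD[OF conc[OF *(3)], of "1/2" x x'] * by (simp add: m_def)
    moreover have "m \<bullet> m = (x \<bullet> x + x' \<bullet> x') / 2 - (norm (x - x'))\<^sup>2 / 4"
      by (simp add: m_def power2_norm_eq_inner inner_add_left inner_add_right inner_diff_left
          inner_diff_right inner_commute[of x' x] add_divide_distrib diff_divide_distrib)
    ultimately show "(\<phi> x y - e n * (x \<bullet> x) + (\<phi> x' y - e n * (x' \<bullet> x'))) / 2
        + e n / 4 * (norm (x - x'))\<^sup>2 \<le> \<phi> ((1/2) *\<^sub>R x + (1/2) *\<^sub>R x') y
          - e n * (((1/2) *\<^sub>R x + (1/2) *\<^sub>R x') \<bullet> ((1/2) *\<^sub>R x + (1/2) *\<^sub>R x'))"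
      unfolding m_def[symmetric] by (rule arith)
  qed
  then obtain u w where u: "\<And>n. u n \<in> X" and w: "\<And>n. w n \<in> Y"
    and uw: "\<And>n x' y'. x' \<in> X \<Longrightarrow> y' \<in> Y \<Longrightarrow>
      \<phi> x' (w n) - e n * (x' \<bullet> x') \<le> \<phi> (u n) y' - e n * (u n \<bullet> u n)"
    by metis
  obtain l r where l: "l \<in> X \<times> Y" and r: "strict_mono (r :: nat \<Rightarrow> nat)"
    and lim: "((\<lambda>n. (u n, w n)) \<circ> r) \<longlonglongrightarrow> l"
  proof -
    have "\<forall>n. (u n, w n) \<in> X \<times> Y" using u w by simp
    with compact_Times[OF X(2) Y(2), unfolded compact_def, THEN spec, of "\<lambda>n. (u n, w n)"]
    show thesis by (auto intro: that simp del: mem_Times_iff)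
  qed
  define x y where "x = fst l" and "y = snd l"
  have x: "x \<in> X" and y: "y \<in> Y" using l by (auto simp: x_def y_def)
  have lim_u: "(\<lambda>n. u (r n)) \<longlonglongrightarrow> x" and lim_w: "(\<lambda>n. w (r n)) \<longlonglongrightarrow> y"
    using tendsto_fst[OF lim] tendsto_snd[OF lim] by (simp_all add: x_def y_def o_def)
  have "\<phi> x' y \<le> \<phi> x y'" if x': "x' \<in> X" and y': "y' \<in> Y" for x' y'
  proof -
    have "e \<longlonglongrightarrow> 0"
      unfolding e_def by (rule LIMSEQ_inverse_real_of_nat)
    then have lim_e: "(\<lambda>n. e (r n) * (x' \<bullet> x')) \<longlonglongrightarrow> 0"
      using LIMSEQ_subseq_LIMSEQ[OF _ r] by (intro tendsto_mult_left_zero) (auto simp: o_def)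
    have lim1: "(\<lambda>n. \<phi> x' (w (r n))) \<longlonglongrightarrow> \<phi> x' y"
      using continuous_on_tendsto_compose[OF cont tendsto_Pair[OF tendsto_const lim_w]] x' y w
      by simp
    have lim2: "(\<lambda>n. \<phi> (u (r n)) y' + e (r n) * (x' \<bullet> x')) \<longlonglongrightarrow> \<phi> x y' + 0"
      using continuous_on_tendsto_compose[OF cont tendsto_Pair[OF lim_u tendsto_const]] y' x u
      by (intro tendsto_add lim_e) simp
    have "\<phi> x' (w (r n)) \<le> \<phi> (u (r n)) y' + e (r n) * (x' \<bullet> x')" for n
    proof -
      have "0 \<le> e (r n) * (u (r n) \<bullet> u (r n))"
        using e[of "r n"] by simp
      with uw[OF x' y', of "r n"] show ?thesis by linarith
    qed
    then show ?thesis
      using LIMSEQ_le[OF lim1 lim2] by auto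
  qed
  with x y show thesis using that by blast
qed

section \<open>The certificate bounds the duality gap\<close>

text \<open>
  The adjoint part of the field reproduces the difference of the bilinear terms exactly; only the
  subgradient inequality for \<open>\<psi>\<close> loses something.
\<close>

lemma dual_field_inner_ge:
  fixes A :: "'y::euclidean_space \<Rightarrow> 'x::euclidean_space"
  assumes "linear A" and "\<psi>' y \<in> subdifferential_on Y \<psi> y" and "z \<in> Y"
  shows "(xX (A y + a) \<bullet> (A y + a) + \<psi> y) - (xX (A y + a) \<bullet> (A z + a) + \<psi> z)
    \<le> dual_field xX A a \<psi>' y \<bullet> (y - z)"
proof -
  have "adjoint A (xX (A y + a)) \<bullet> (y - z) = xX (A y + a) \<bullet> (A y - A z)"
    using adjoint_works[OF assms(1)] linear_diff[OF assms(1)] by (metis inner_commute)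
  moreover have "\<psi> y - \<psi> z \<le> \<psi>' y \<bullet> (y - z)"
    using assms(2,3) by (auto simp: subdifferential_on_def inner_diff_right dest!: bspec[of _ _ z])
  ultimately show ?thesis
    by (simp add: dual_field_def inner_simps)
qed

theorem proposition2p1:
  fixes X :: "'x::euclidean_space set" and Y :: "'y::euclidean_space set"
    and xX :: "'x \<Rightarrow> 'x" and A :: "'y \<Rightarrow> 'x" and a :: 'x
    and \<psi> :: "'y \<Rightarrow> real" and \<psi>' :: "'y \<Rightarrow> 'y"
    and t :: nat and ys :: "nat \<Rightarrow> 'y" and lam :: "nat \<Rightarrow> real"
    and xhat :: 'x and yhat :: 'y
  assumes X: "X \<noteq> {}" "closed X" "bounded X" "convex X"
    and xX: "is_linear_max_oracle X xX"
    and Y: "Y \<noteq> {}" "convex Y" "compact Y"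
    and A: "linear A"
    and \<psi>_convex: "convex_on Y \<psi>"
    and \<psi>_lipschitz: "\<exists>L. L-lipschitz_on Y \<psi>"
    and \<psi>': "\<forall>y\<in>Y. \<psi>' y \<in> subdifferential_on Y \<psi> y"
    and ys: "\<forall>\<tau>\<in>{1..t}. ys \<tau> \<in> Y"
    and lam_nonneg: "\<forall>\<tau>\<in>{1..t}. 0 \<le> lam \<tau>"
    and lam_sum: "(\<Sum>\<tau>=1..t. lam \<tau>) = 1"
    and xhat: "xhat = (\<Sum>\<tau>=1..t. lam \<tau> *\<^sub>R xX (A (ys \<tau>) + a))"
    and yhat: "yhat = (\<Sum>\<tau>=1..t. lam \<tau> *\<^sub>R ys \<tau>)"
  shows "xhat \<in> X \<and> yhat \<in> Y \<and>
    dual_obj X A a \<psi> yhat - primal_obj Y A a \<psi> xhat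
      = (dual_obj X A a \<psi> yhat - OptD X Y A a \<psi>) + (OptP X Y A a \<psi> - primal_obj Y A a \<psi> xhat) \<and>
    (dual_obj X A a \<psi> yhat - OptD X Y A a \<psi>) + (OptP X Y A a \<psi> - primal_obj Y A a \<psi> xhat)
      \<le> certificate_accuracy Y t ys (\<lambda>\<tau>. dual_field xX A a \<psi>' (ys \<tau>)) lam"
proof -
  define \<phi> where "\<phi> x y = x \<bullet> (A y + a) + \<psi> y" for x y
  define \<epsilon> where "\<epsilon> = certificate_accuracy Y t ys (\<lambda>\<tau>. dual_field xX A a \<psi>' (ys \<tau>)) lam"
  define xs where "xs \<tau> = xX (A (ys \<tau>) + a)" for \<tau>
  have compact_X: "compact X"
    using X by (simp add: compact_eq_bounded_closed)
  have xX_optimal: "xX \<xi> \<in> X" "x \<in> X \<Longrightarrow> x \<bullet> \<xi> \<le> xX \<xi> \<bullet> \<xi>" for \<xi> x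
    using xX by (auto simp: is_linear_max_oracle_def inner_commute)
  have xX_maximises: "\<phi> x y \<le> \<phi> (xX (A y + a)) y" if "x \<in> X" for x y
    using xX_optimal(2)[OF that] by (simp add: \<phi>_def)
  have xhat_X: "xhat \<in> X"
    unfolding xhat using X(4) lam_nonneg lam_sum xX_optimal(1) by (intro convex_sum) auto
  have yhat_Y: "yhat \<in> Y"
    unfolding yhat using Y(2) lam_nonneg lam_sum ys by (intro convex_sum) auto

  have cont_\<psi>: "continuous_on Y \<psi>"
    using \<psi>_lipschitz lipschitz_on_continuous_on by blast
  have cont_A: "continuous_on S A" for S
    using A by (simp add: linear_continuous_on linear_conv_bounded_linear)
  have cont_y: "continuous_on Y (\<phi> x)" for x
    unfolding \<phi>_def by (intro continuous_intros cont_A cont_\<psi>)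
  have cont: "continuous_on (X \<times> Y) (\<lambda>p. \<phi> (fst p) (snd p))"
    unfolding \<phi>_def
    by (intro continuous_intros continuous_on_compose2[OF cont_A[of Y]]
        continuous_on_compose2[OF cont_\<psi>]) auto
  have convex_y: "convex_on Y (\<phi> x)" for x
  proof -
    have "convex_on Y (\<lambda>y. x \<bullet> (A y + a))"
      using Y(2) A
      by (auto simp: convex_on_def linear_add linear_scale inner_simps
          simp flip: distrib_right)
    then show ?thesis
      unfolding \<phi>_def using \<psi>_convex by (intro convex_on_add)
  qed
  have concave_x: "concave_on X (\<lambda>x. \<phi> x y)" for y
    using X(4) unfolding concave_on_iff \<phi>_def
    by (auto simp: inner_add_left algebra_simps simp flip: distrib_right)

  have dual_obj_eq: "dual_obj X A a \<psi> y = \<phi> (xX (A y + a)) y" for y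
    unfolding dual_obj_def \<phi>_def
    using xX_optimal by (intro max_over_eqI[where g = "\<lambda>x. x \<bullet> (A y + a) + \<psi> y"]) auto
  have primal_obj_attained: "\<exists>z\<in>Y. primal_obj Y A a \<psi> x = \<phi> x z \<and> (\<forall>y\<in>Y. \<phi> x z \<le> \<phi> x y)" for x
  proof -
    obtain z where z: "z \<in> Y" "\<forall>y\<in>Y. \<phi> x z \<le> \<phi> x y"
      using continuous_attains_inf[OF Y(3,1) cont_y] by blast
    then have "primal_obj Y A a \<psi> x = \<phi> x z"
      unfolding primal_obj_def \<phi>_def by (intro min_over_eqI) auto
    with z show ?thesis by blast
  qed
  have primal_obj_le: "primal_obj Y A a \<psi> x \<le> \<phi> x y" if "y \<in> Y" for x y
    using primal_obj_attained[of x] that by auto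

  have strong_duality: "OptP X Y A a \<psi> = OptD X Y A a \<psi>"
  proof -
    obtain x y where xy: "x \<in> X" "y \<in> Y"
      and saddle: "\<And>x' y'. x' \<in> X \<Longrightarrow> y' \<in> Y \<Longrightarrow> \<phi> x' y \<le> \<phi> x y'"
      using concave_convex_saddle_point[of X Y \<phi>, OF X(1) compact_X X(4) Y(1,3,2) cont
          concave_x convex_y] by blast
    have primal: "primal_obj Y A a \<psi> = (\<lambda>x. min_over Y (\<phi> x))"
      and dual: "dual_obj X A a \<psi> = (\<lambda>y. max_over X (\<lambda>x. \<phi> x y))"
      by (auto simp: fun_eq_iff primal_obj_def dual_obj_def \<phi>_def[abs_def])
    show ?thesis
      unfolding OptP_def OptD_def primal dual
    proof (rule saddle_point_max_min_eq_min_max[where \<phi> = \<phi>, OF xy saddle])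
      fix x' y' assume "x' \<in> X" "y' \<in> Y"
      then show "min_over Y (\<phi> x') \<le> \<phi> x' y'" "\<phi> x' y' \<le> max_over X (\<lambda>x. \<phi> x y')"
        using primal_obj_le[of y' x'] dual_obj_eq[of y'] xX_maximises[of x' y']
        by (simp_all add: primal dual)
    qed
  qed

  have gap: "dual_obj X A a \<psi> yhat - primal_obj Y A a \<psi> xhat \<le> \<epsilon>"
  proof -
    let ?x = "xX (A yhat + a)"
    let ?g = "\<lambda>y. \<Sum>\<tau>=1..t. lam \<tau> * (dual_field xX A a \<psi>' (ys \<tau>) \<bullet> (ys \<tau> - y))"
    obtain z where z: "z \<in> Y" "primal_obj Y A a \<psi> xhat = \<phi> xhat z"
      using primal_obj_attained by blast
    \<comment> \<open>Freezing the maximiser at \<open>yhat\<close> lets convexity in \<open>y\<close> act before \<open>x\<close> is re-optimised at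
      each \<open>ys \<tau>\<close>.\<close>
    have "dual_obj X A a \<psi> yhat = \<phi> ?x (\<Sum>\<tau>=1..t. lam \<tau> *\<^sub>R ys \<tau>)"
      using dual_obj_eq yhat by simp
    also have "\<dots> \<le> (\<Sum>\<tau>=1..t. lam \<tau> * \<phi> ?x (ys \<tau>))"
      using lam_sum lam_nonneg ys Y(2) convex_y
      by (intro convex_on_sum) (auto intro: ccontr)
    also have "\<dots> \<le> (\<Sum>\<tau>=1..t. lam \<tau> * \<phi> (xs \<tau>) (ys \<tau>))"
      using lam_nonneg xX_maximises[OF xX_optimal(1)] unfolding xs_def
      by (intro sum_mono mult_left_mono) auto
    finally have upper: "dual_obj X A a \<psi> yhat \<le> (\<Sum>\<tau>=1..t. lam \<tau> * \<phi> (xs \<tau>) (ys \<tau>))" .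
    have "\<phi> xhat z = (\<Sum>\<tau>=1..t. lam \<tau> * (xs \<tau> \<bullet> (A z + a))) + (\<Sum>\<tau>=1..t. lam \<tau>) * \<psi> z"
      using lam_sum by (simp add: \<phi>_def xhat xs_def inner_sum_left)
    also have "\<dots> = (\<Sum>\<tau>=1..t. lam \<tau> * \<phi> (xs \<tau>) z)"
      by (simp add: \<phi>_def distrib_left sum.distrib sum_distrib_right)
    finally have affine: "\<phi> xhat z = (\<Sum>\<tau>=1..t. lam \<tau> * \<phi> (xs \<tau>) z)" .
    have "dual_obj X A a \<psi> yhat - primal_obj Y A a \<psi> xhat
        \<le> (\<Sum>\<tau>=1..t. lam \<tau> * (\<phi> (xs \<tau>) (ys \<tau>) - \<phi> (xs \<tau>) z))"
      using upper affine z(2) by (simp add: right_diff_distrib sum_subtractf)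
    also have "\<dots> \<le> ?g z"
      using lam_nonneg ys \<psi>' z(1) dual_field_inner_ge[OF A, of \<psi>' _ Y \<psi> z xX a]
      unfolding xs_def \<phi>_def by (intro sum_mono mult_left_mono) auto
    also have "\<dots> \<le> \<epsilon>"
      unfolding \<epsilon>_def certificate_accuracy_def
      by (intro max_over_upper[where g = ?g] Y(3) z(1) continuous_intros)
    finally show ?thesis .
  qed
  show ?thesis
    using xhat_X yhat_Y strong_duality gap by (simp add: \<epsilon>_def)
qed

end
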